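(* Let $n\ge 0$ be an integer. There exists a cross product on $\mathbf{R}^n$ if and only if $n\in\{0,1,3,7\}$. Moreover, for every cross product $\times$ on $\mathbf{R}^3$ there is an orthonormal basis $S_1$ of $\mathbf{R}^3$ such that $S_1\times S_1=\pm S_1\cup\{0\}$, and for every cross product $\times$ on $\mathbf{R}^7$ there is an orthonormal basis $S_2$ of $\mathbf{R}^7$ such that $S_2\times S_2=\pm S_2\cup\{0\}$.
   Context: Let $u\cdot v$ denote the standard dot product on $\mathbf{R}^n$. A cross product on $\mathbf{R}^n$ is a function $\mathbf{R}^n\times\mathbf{R}^n\to\mathbf{R}^n$ (Cartesian product on the left), written $(u,v)\mapsto u\times v$, such that for all $u,v,\widetilde u,\widetilde v\in\mathbf{R}^n$ and all $a,b,c,d\in\mathbf{R}$: (perpendicular property) $u\cdot(u\times v)=0$ and $v\cdot(u\times v)=0$; (Pythagorean property) $(u\times v)\cdot(u\times v)+(u\cdot v)^2=(u\cdot u)(v\cdot v)$; (bilinear property) $(au+b\widetilde u)\times(cv+d\widetilde v)=ac(u\times v)+ad(u\times\widetilde v)+bc(\widetilde u\times v)+bd(\widetilde u\times\widetilde v)$. For subsets $S,T\subseteq\mathbf{R}^n$, $S\times T:=\{u\times v : u\in S,\ v\in T\}$ (cross products, not the Cartesian product), and $\pm S:=S\cup(-S)$. *)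

theory Defs
  imports "Jordan_Normal_Form.VS_Connect"
begin

text \<open>The space \<open>\<real>\<^sup>n\<close> is \<^term>\<open>carrier_vec n :: real vec set\<close>, which covers \<open>n = 0\<close> and
  lets \<open>n\<close> vary inside a formula; its dot product is \<open>u \<bullet> v\<close>. A product on \<open>\<real>\<^sup>n\<close> is therefore a
  function on \<^typ>\<open>real vec\<close> of which only the values on \<^term>\<open>carrier_vec n\<close> matter.\<close>

definition cross_product :: "nat \<Rightarrow> (real vec \<Rightarrow> real vec \<Rightarrow> real vec) \<Rightarrow> bool" where
  "cross_product n cp \<longleftrightarrow>
    (\<forall>u \<in> carrier_vec n. \<forall>v \<in> carrier_vec n. cp u v \<in> carrier_vec n) \<and>
    (\<forall>u \<in> carrier_vec n. \<forall>v \<in> carrier_vec n. u \<bullet> cp u v = 0 \<and> v \<bullet> cp u v = 0) \<and>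
    (\<forall>u \<in> carrier_vec n. \<forall>v \<in> carrier_vec n.
      cp u v \<bullet> cp u v + (u \<bullet> v)\<^sup>2 = (u \<bullet> u) * (v \<bullet> v)) \<and>
    (\<forall>u \<in> carrier_vec n. \<forall>u' \<in> carrier_vec n. \<forall>v \<in> carrier_vec n. \<forall>v' \<in> carrier_vec n.
      \<forall>a b c d. cp (a \<cdot>\<^sub>v u + b \<cdot>\<^sub>v u') (c \<cdot>\<^sub>v v + d \<cdot>\<^sub>v v') =
        (a * c) \<cdot>\<^sub>v cp u v + (a * d) \<cdot>\<^sub>v cp u v' + (b * c) \<cdot>\<^sub>v cp u' v + (b * d) \<cdot>\<^sub>v cp u' v')"

definition cross_set :: "('a \<Rightarrow> 'a \<Rightarrow> 'a) \<Rightarrow> 'a set \<Rightarrow> 'a set \<Rightarrow> 'a set" where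
  "cross_set cp S T = {cp u v | u v. u \<in> S \<and> v \<in> T}"

definition plus_minus :: "real vec set \<Rightarrow> real vec set" where
  "plus_minus S = S \<union> uminus ` S"

definition orthonormal_basis :: "nat \<Rightarrow> real vec set \<Rightarrow> bool" where
  "orthonormal_basis n S \<longleftrightarrow>
    vectorspace.basis class_ring (module_vec TYPE(real) n) S \<and>
    (\<forall>u \<in> S. u \<bullet> u = 1) \<and> (\<forall>u \<in> S. \<forall>v \<in> S. u \<noteq> v \<longrightarrow> u \<bullet> v = 0)"

end

theory Submission
  imports Defs
begin

text \<open>Polarizing the axioms shows that \<open>u \<bullet> (v \<times> w)\<close> is an alternating trilinear form and that left
  products satisfy the Clifford relations: for a unit vector \<open>u\<close>, \<open>u \<times> (u \<times> v) = - v\<close> on the orthogonal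
  complement of \<open>u\<close> (\<open>cross_cross_unit\<close>), and \<open>u \<times> (v \<times> w) = - (v \<times> (u \<times> w))\<close> for mutually orthogonal
  \<open>u\<close>, \<open>v\<close>, \<open>w\<close> (\<open>swap_orthogonal\<close>), which also makes such triples anti-associative (\<open>anti_associate\<close>).

  The main object is a closed frame: an orthonormal set \<open>S\<close> whose products are, up to sign, elements
  of \<open>S\<close> or zero. If \<open>S\<close> does not span the space, pick a unit vector \<open>z\<close> orthogonal to it; the Clifford
  relations show that \<open>S \<union> {z} \<union> z \<times> S\<close> is again a closed frame, with \<open>2 |S| + 1\<close> elements
  (\<open>closed_frame_double\<close>). Starting from the empty set, the sizes are \<open>0, 1, 3, 7\<close>. A closed frame with
  seven elements must span: together with a further orthogonal unit vector \<open>w\<close> it would contain four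
  vectors for which two ways of moving brackets by anti-associativity contradict each other
  (\<open>no_generic_quadruple\<close>). So \<open>n\<close> is one of \<open>0, 1, 3, 7\<close>, and the space has a closed frame as an
  orthonormal basis. For \<open>n \<ge> 2\<close> the products of such a basis exhaust \<open>\<plusminus>S \<union> {0}\<close>
  (\<open>closed_frame_cross_set\<close>), which yields the bases in dimensions \<open>3\<close> and \<open>7\<close>.

  Conversely, the product is zero for \<open>n \<le> 1\<close>, and comes from the imaginary quaternions and octonions
  for \<open>n = 3\<close> and \<open>n = 7\<close>.\<close>

section \<open>Orthonormal sets in \<open>\<real>\<^sup>n\<close>\<close>

lemma scalar_prod_self_eq_0_iff:
  fixes v :: "real vec"
  shows "v \<bullet> v = 0 \<longleftrightarrow> v = 0\<^sub>v (dim_vec v)"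
proof
  assume "v = 0\<^sub>v (dim_vec v)"
  then show "v \<bullet> v = 0" by (metis carrier_vec_dim_vec scalar_prod_left_zero)
qed (auto simp: scalar_prod_def sum_nonneg_eq_0_iff)

lemma eq_vec_by_scalar_prod:
  fixes x y :: "real vec"
  assumes "x \<in> carrier_vec n" "y \<in> carrier_vec n"
    and "\<And>w. w \<in> carrier_vec n \<Longrightarrow> w \<bullet> x = w \<bullet> y"
  shows "x = y"
proof (rule eq_vecI)
  fix i assume "i < dim_vec y"
  then show "x $ i = y $ i"
    using assms(3)[of "unit_vec n i"] assms(1,2) by simp
qed (use assms in auto)

definition orthonormal :: "nat \<Rightarrow> real vec set \<Rightarrow> bool" where
  "orthonormal n S \<longleftrightarrow> S \<subseteq> carrier_vec n \<and> finite S \<and>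
    (\<forall>u \<in> S. u \<bullet> u = 1) \<and> (\<forall>u \<in> S. \<forall>v \<in> S. u \<noteq> v \<longrightarrow> u \<bullet> v = 0)"

lemma orthonormal_lin_indpt:
  assumes "orthonormal n S"
  shows "module.lin_indpt class_ring (module_vec TYPE(real) n) S"
proof -
  interpret vec_space "TYPE(real)" n .
  have S: "S \<subseteq> carrier_vec n" "finite S"
    and norm1: "\<And>u. u \<in> S \<Longrightarrow> u \<bullet> u = 1"
    and orth: "\<And>u v. u \<in> S \<Longrightarrow> v \<in> S \<Longrightarrow> u \<noteq> v \<Longrightarrow> u \<bullet> v = 0"
    using assms unfolding orthonormal_def by auto
  have coeff0: "\<forall>v\<in>S. a v = 0" if "lincomb a S = 0\<^sub>v n" for a
  proof -
    from that have zero: "finsum V (\<lambda>u. a u \<cdot>\<^sub>v u) S = 0\<^sub>v n"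
      by (simp add: lincomb_def)
    show ?thesis
    proof
      fix v assume v: "v \<in> S"
      have summand: "(a u \<cdot>\<^sub>v u) \<bullet> v = (if u = v then a v else 0)" if u: "u \<in> S" for u
      proof -
        have "(a u \<cdot>\<^sub>v u) \<bullet> v = a u * (u \<bullet> v)"
          using u v S by (intro smult_scalar_prod_distrib) auto
        then show ?thesis
          using u v norm1 orth by simp
      qed
      have "0 = finsum V (\<lambda>u. a u \<cdot>\<^sub>v u) S \<bullet> v"
        using zero v S by auto
      also have "\<dots> = (\<Sum>u\<in>S. (a u \<cdot>\<^sub>v u) \<bullet> v)"
        by (rule finsum_scalar_prod_sum) (use v S in auto)
      also have "\<dots> = (\<Sum>u\<in>S. if u = v then a v else 0)"
        by (intro sum.cong refl summand)
      also have "\<dots> = a v"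
        using v S by simp
      finally show "a v = 0" by simp
    qed
  qed
  show ?thesis
    by (rule finite_lin_indpt2) (use S coeff0 in auto)
qed

lemma card_orthonormal_le:
  assumes "orthonormal n S"
  shows "card S \<le> n"
proof -
  interpret vec_space "TYPE(real)" n .
  show ?thesis
    using li_le_dim(2)[OF fin_dim _ orthonormal_lin_indpt[OF assms]] assms
    by (simp add: dim_is_n orthonormal_def)
qed

lemma orthonormal_basisI:
  assumes "orthonormal n S" "card S = n"
  shows "orthonormal_basis n S"
proof -
  interpret vec_space "TYPE(real)" n .
  have "basis S"
    by (rule dim_li_is_basis) (use assms orthonormal_lin_indpt[OF assms(1)] in
      \<open>auto simp: dim_is_n orthonormal_def\<close>)
  then show ?thesis
    using assms by (auto simp: orthonormal_basis_def orthonormal_def)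
qed

text \<open>The vectors of \<open>S\<close> are the rows of a square matrix that is padded with at least one zero row;
  its determinant vanishes, and a nonzero vector of its kernel is orthogonal to all of \<open>S\<close>.\<close>

lemma exists_unit_orthogonal:
  assumes "orthonormal n S" "card S < n"
  obtains z where "z \<in> carrier_vec n" "z \<bullet> z = 1" "\<And>s. s \<in> S \<Longrightarrow> s \<bullet> z = 0"
proof -
  have S: "S \<subseteq> carrier_vec n" "finite S"
    using assms unfolding orthonormal_def by auto
  obtain xs where xs: "set xs = S" "distinct xs" using S finite_distinct_list by blast
  define c where "c i = (if i < card S then xs ! i else 0\<^sub>v n)" for i
  have len: "length xs = card S" using xs distinct_card by force
  have c: "c \<in> {0..<n} \<rightarrow> carrier_vec n"
    using S xs len by (auto simp: c_def) (metis nth_mem subsetD)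
  define A where "A = mat\<^sub>r n n (\<lambda>i. if i = card S then 0\<^sub>v n else c i)"
  have A: "A \<in> carrier_mat n n" by (simp add: A_def)
  have "det A = 0" unfolding A_def by (rule det_row_0[OF assms(2) c])
  then obtain v where v: "v \<in> carrier_vec n" "v \<noteq> 0\<^sub>v n" "A *\<^sub>v v = 0\<^sub>v n"
    using det_0_iff_vec_prod_zero_field[OF A] by blast
  have sv: "s \<bullet> v = 0" if s: "s \<in> S" for s
  proof -
    obtain i where i: "i < card S" "s = xs ! i"
      using s len xs(1) by (auto simp: set_conv_nth)
    have "row A i = s"
      using i assms(2) s S by (auto simp: A_def c_def)
    then show ?thesis
      using arg_cong[OF v(3), of "\<lambda>x. x $ i"] i assms(2) A by auto
  qed
  have pos: "v \<bullet> v > 0"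
    using v scalar_prod_self_eq_0_iff[of v] by (auto simp: scalar_prod_def less_le intro: sum_nonneg)
  define z where "z = (1 / sqrt (v \<bullet> v)) \<cdot>\<^sub>v v"
  show thesis
  proof
    show "z \<in> carrier_vec n" using v by (simp add: z_def)
    show "z \<bullet> z = 1" using v pos by (simp add: z_def field_simps)
    show "s \<bullet> z = 0" if "s \<in> S" for s
      using sv[OF that] v S that by (auto simp: z_def subset_iff)
  qed
qed

section \<open>Cross products, closed frames and the restriction on the dimension\<close>

lemma self_negative_zero:
  fixes x :: "real vec"
  assumes "x \<in> carrier_vec n" "x = - x"
  shows "x = 0\<^sub>v n"
proof (rule eq_vecI)
  fix i assume "i < dim_vec (0\<^sub>v n :: real vec)"
  then show "x $ i = 0\<^sub>v n $ i"
    using arg_cong[OF assms(2), of "\<lambda>y. y $ i"] assms(1) by simp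
qed (use assms in simp)

locale cross_product_on =
  fixes n :: nat and cp :: "real vec \<Rightarrow> real vec \<Rightarrow> real vec" (infixl \<open>\<star>\<close> 75)
  assumes cross_product: "cross_product n cp"
begin

lemma cross_carrier [simp]: "u \<in> carrier_vec n \<Longrightarrow> v \<in> carrier_vec n \<Longrightarrow> u \<star> v \<in> carrier_vec n"
  using cross_product unfolding cross_product_def by blast

lemma dim_cross [simp]: "u \<in> carrier_vec n \<Longrightarrow> v \<in> carrier_vec n \<Longrightarrow> dim_vec (u \<star> v) = n"
  using cross_carrier by (simp add: carrier_vecD)

lemma perp_left: "u \<in> carrier_vec n \<Longrightarrow> v \<in> carrier_vec n \<Longrightarrow> u \<bullet> (u \<star> v) = 0"
  and perp_right: "u \<in> carrier_vec n \<Longrightarrow> v \<in> carrier_vec n \<Longrightarrow> v \<bullet> (u \<star> v) = 0"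
  using cross_product unfolding cross_product_def by blast+

lemma pythagoras:
  "u \<in> carrier_vec n \<Longrightarrow> v \<in> carrier_vec n \<Longrightarrow>
    (u \<star> v) \<bullet> (u \<star> v) = (u \<bullet> u) * (v \<bullet> v) - (u \<bullet> v)\<^sup>2"
  using cross_product unfolding cross_product_def by (simp add: eq_diff_eq)

lemma bilinear:
  assumes "u \<in> carrier_vec n" "u' \<in> carrier_vec n" "v \<in> carrier_vec n" "v' \<in> carrier_vec n"
  shows "(a \<cdot>\<^sub>v u + b \<cdot>\<^sub>v u') \<star> (c \<cdot>\<^sub>v v + d \<cdot>\<^sub>v v') =
      (a * c) \<cdot>\<^sub>v (u \<star> v) + (a * d) \<cdot>\<^sub>v (u \<star> v') + (b * c) \<cdot>\<^sub>v (u' \<star> v) + (b * d) \<cdot>\<^sub>v (u' \<star> v')"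
  using cross_product assms unfolding cross_product_def by blast

lemma scalar_prod_uminus:
  fixes u v :: "real vec"
  shows "u \<in> carrier_vec n \<Longrightarrow> v \<in> carrier_vec n \<Longrightarrow> u \<bullet> - v = - (u \<bullet> v)"
  using scalar_prod_uminus_right[of u v] by (simp add: carrier_vecD[of _ n])

lemma zero_smult: "x \<in> carrier_vec n \<Longrightarrow> (0::real) \<cdot>\<^sub>v x = 0\<^sub>v n"
  by auto

lemma
  assumes "u \<in> carrier_vec n" "v \<in> carrier_vec n" "w \<in> carrier_vec n"
  shows add_left: "(u + v) \<star> w = u \<star> w + v \<star> w"
    and add_right: "w \<star> (u + v) = w \<star> u + w \<star> v"
  using bilinear[OF assms(1,2,3,3), of 1 1 1 0] bilinear[OF assms(3,3,1,2), of 1 0 1 1] assms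
  by (simp_all add: zero_smult)

lemma
  assumes "u \<in> carrier_vec n" "v \<in> carrier_vec n"
  shows minus_left: "(- u) \<star> v = - (u \<star> v)"
    and minus_right: "u \<star> (- v) = - (u \<star> v)"
proof -
  have neg: "(-1) \<cdot>\<^sub>v x = - x" for x :: "real vec" by auto
  show "(- u) \<star> v = - (u \<star> v)" "u \<star> (- v) = - (u \<star> v)"
    using bilinear[OF assms(1,1,2,2), of "-1" 0 1 0] bilinear[OF assms(1,1,2,2), of 1 0 "-1" 0]
      assms by (simp_all add: zero_smult neg)
qed

lemma
  assumes "u \<in> carrier_vec n"
  shows zero_left: "0\<^sub>v n \<star> u = 0\<^sub>v n"
    and zero_right: "u \<star> 0\<^sub>v n = 0\<^sub>v n"
  using bilinear[OF assms assms assms assms, of 0 0 1 0]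
    bilinear[OF assms assms assms assms, of 1 0 0 0] assms
  by (simp_all add: zero_smult)

text \<open>Together with \<open>triple_swap_right\<close>, this says that the trilinear form \<open>u \<bullet> (v \<star> w)\<close> is
  alternating: the perpendicular property makes it vanish when the first argument repeats another
  one, and polarization turns that into the sign changes.\<close>

lemma triple_swap_left:
  assumes [simp]: "u \<in> carrier_vec n" "v \<in> carrier_vec n" "w \<in> carrier_vec n"
  shows "u \<bullet> (v \<star> w) = - (v \<bullet> (u \<star> w))"
  using perp_left[of "u + v" w] perp_left[of u w] perp_left[of v w]
  by (simp add: add_left add_scalar_prod_distrib[of _ n] scalar_prod_add_distrib[of _ n])

lemma triple_swap_right:
  assumes [simp]: "u \<in> carrier_vec n" "v \<in> carrier_vec n" "w \<in> carrier_vec n"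
  shows "u \<bullet> (v \<star> w) = - (w \<bullet> (v \<star> u))"
  using perp_right[of v "u + w"] perp_right[of v u] perp_right[of v w]
  by (simp add: add_right add_scalar_prod_distrib[of _ n] scalar_prod_add_distrib[of _ n])

lemma anticommute:
  assumes [simp]: "v \<in> carrier_vec n" "w \<in> carrier_vec n"
  shows "v \<star> w = - (w \<star> v)"
proof (rule eq_vec_by_scalar_prod)
  fix u :: "real vec" assume [simp]: "u \<in> carrier_vec n"
  show "u \<bullet> (v \<star> w) = u \<bullet> - (w \<star> v)"
    using triple_swap_left[of u v w] triple_swap_right[of v u w] triple_swap_left[of w u v]
    by simp
qed auto

lemma self_zero: "v \<in> carrier_vec n \<Longrightarrow> v \<star> v = 0\<^sub>v n"
  using pythagoras[of v v] scalar_prod_self_eq_0_iff[of "v \<star> v"] by (simp add: power2_eq_square)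

lemma polarized_pythagoras:
  assumes [simp]: "u \<in> carrier_vec n" "v \<in> carrier_vec n" "w \<in> carrier_vec n"
  shows "(u \<star> v) \<bullet> (u \<star> w) = (u \<bullet> u) * (v \<bullet> w) - (u \<bullet> v) * (u \<bullet> w)"
  using pythagoras[of u "v + w"] pythagoras[of u v] pythagoras[of u w]
    comm_scalar_prod[of v n w] comm_scalar_prod[of "u \<star> v" n "u \<star> w"]
  by (simp add: add_right add_scalar_prod_distrib[of _ n] scalar_prod_add_distrib[of _ n]
      power2_eq_square algebra_simps)

text \<open>The Pythagorean property is of degree two in each factor; polarizing it in the right factor
  gives the previous identity, and polarizing that one in the left factor gives this one.\<close>

lemma bipolarized_pythagoras:
  assumes [simp]: "u \<in> carrier_vec n" "x \<in> carrier_vec n" "v \<in> carrier_vec n" "w \<in> carrier_vec n"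
  shows "(u \<star> v) \<bullet> (x \<star> w) + (x \<star> v) \<bullet> (u \<star> w) =
    2 * (u \<bullet> x) * (v \<bullet> w) - (u \<bullet> v) * (x \<bullet> w) - (x \<bullet> v) * (u \<bullet> w)"
  using polarized_pythagoras[of "u + x" v w] polarized_pythagoras[of u v w]
    polarized_pythagoras[of x v w] comm_scalar_prod[of x n u]
  by (simp add: add_left add_scalar_prod_distrib[of _ n] scalar_prod_add_distrib[of _ n]
      algebra_simps)

text \<open>By the alternating form, \<open>w \<bullet> (u \<star> (u \<star> v)) = - ((u \<star> v) \<bullet> (u \<star> w))\<close>, and the
  polarized Pythagorean identity evaluates the right-hand side. So the product by a unit vector acts
  as a square root of \<open>-1\<close> on the orthogonal complement of that vector.\<close>

lemma cross_cross_unit: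
  assumes [simp]: "u \<in> carrier_vec n" "v \<in> carrier_vec n"
    and "u \<bullet> u = 1" "u \<bullet> v = 0"
  shows "u \<star> (u \<star> v) = - v"
proof (rule eq_vec_by_scalar_prod)
  fix w :: "real vec" assume [simp]: "w \<in> carrier_vec n"
  show "w \<bullet> (u \<star> (u \<star> v)) = w \<bullet> - v"
    using triple_swap_right[of w u "u \<star> v"] polarized_pythagoras[of u v w]
      comm_scalar_prod[of v n w] assms
    by (simp add: scalar_prod_uminus)
qed auto

text \<open>The same computation with the identity polarized in both factors. It is the Clifford relation:
  left products by orthogonal vectors anticommute on vectors orthogonal to both.\<close>

lemma swap_orthogonal:
  assumes [simp]: "u \<in> carrier_vec n" "v \<in> carrier_vec n" "w \<in> carrier_vec n"
    and "u \<bullet> v = 0" "u \<bullet> w = 0" "v \<bullet> w = 0"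
  shows "u \<star> (v \<star> w) = - (v \<star> (u \<star> w))"
proof (rule eq_vec_by_scalar_prod)
  fix y :: "real vec" assume [simp]: "y \<in> carrier_vec n"
  show "y \<bullet> (u \<star> (v \<star> w)) = y \<bullet> - (v \<star> (u \<star> w))"
    using triple_swap_right[of y u "v \<star> w"] triple_swap_right[of y v "u \<star> w"]
      bipolarized_pythagoras[of u v w y] assms by simp
qed auto

lemma anti_associate:
  assumes [simp]: "u \<in> carrier_vec n" "v \<in> carrier_vec n" "w \<in> carrier_vec n"
    and "u \<bullet> v = 0" "u \<bullet> w = 0" "v \<bullet> w = 0"
  shows "u \<star> (v \<star> w) = - ((u \<star> v) \<star> w)"
proof -
  have "u \<star> (v \<star> w) = - (u \<star> (w \<star> v))"
    using anticommute[of v w] by (simp add: minus_right)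
  also have "\<dots> = w \<star> (u \<star> v)"
    using swap_orthogonal[of u w v] assms comm_scalar_prod[of w n v] by simp
  also have "\<dots> = - ((u \<star> v) \<star> w)"
    by (rule anticommute) auto
  finally show ?thesis .
qed

text \<open>The obstruction in dimensions above seven. Moving the brackets in \<open>s \<star> (t \<star> (z \<star> w))\<close> to the
  left by anti-associativity can be done in two ways, along the two sides of the associativity
  pentagon that consist of three moves and of two moves. Each move costs a sign, so the results
  have opposite signs. Both are \<open>\<plusminus> ((s \<star> t) \<star> z) \<star> w\<close>, which is a unit vector.\<close>

lemma no_generic_quadruple:
  assumes [simp]: "s \<in> carrier_vec n" "t \<in> carrier_vec n" "z \<in> carrier_vec n" "w \<in> carrier_vec n"
    and unit: "s \<bullet> s = 1" "t \<bullet> t = 1" "z \<bullet> z = 1" "w \<bullet> w = 1"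
    and stz: "s \<bullet> t = 0" "s \<bullet> z = 0" "t \<bullet> z = 0" "(s \<star> t) \<bullet> z = 0"
    and w: "s \<bullet> w = 0" "t \<bullet> w = 0" "z \<bullet> w = 0"
      "(s \<star> t) \<bullet> w = 0" "(s \<star> z) \<bullet> w = 0" "(t \<star> z) \<bullet> w = 0" "((s \<star> t) \<star> z) \<bullet> w = 0"
  shows False
proof -
  let ?p = "(s \<star> t) \<star> z"
  have a: "s \<bullet> (t \<star> z) = 0"
    using triple_swap_right[of s t z] stz anticommute[of t s] comm_scalar_prod[of z n "s \<star> t"]
    by simp
  have b: "t \<bullet> (z \<star> w) = 0" "s \<bullet> (z \<star> w) = 0"
    using triple_swap_right[of t z w] triple_swap_right[of s z w] w anticommute[of z t]
      anticommute[of z s] comm_scalar_prod[of w n "t \<star> z"] comm_scalar_prod[of w n "s \<star> z"]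
    by simp_all
  \<comment> \<open>Three moves, hence the sign \<open>-\<close>.\<close>
  have "s \<star> (t \<star> (z \<star> w)) = (s \<star> (t \<star> z)) \<star> w"
    using anti_associate[of t z w] anti_associate[of s "t \<star> z" w] a stz w
    by (simp add: minus_right)
  also have "\<dots> = - (?p \<star> w)"
    using anti_associate[of s t z] stz by (simp add: minus_left)
  finally have 1: "s \<star> (t \<star> (z \<star> w)) = - (?p \<star> w)" .
  \<comment> \<open>Two moves, through \<open>(s \<star> t) \<star> (z \<star> w)\<close>, hence the sign \<open>+\<close>.\<close>
  have 2: "s \<star> (t \<star> (z \<star> w)) = ?p \<star> w"
    using anti_associate[of s t "z \<star> w"] anti_associate[of "s \<star> t" z w] b stz w by simp
  have "?p \<star> w = 0\<^sub>v n"
    using 1 2 self_negative_zero[of "?p \<star> w" n] by simp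
  moreover have "(?p \<star> w) \<bullet> (?p \<star> w) = 1"
    using pythagoras[of ?p w] pythagoras[of "s \<star> t" z] pythagoras[of s t] unit stz w by simp
  ultimately show False by simp
qed

abbreviation signed :: "real vec set \<Rightarrow> real vec set" where
  "signed S \<equiv> plus_minus S \<union> {0\<^sub>v n}"

lemma signed_uminus: "x \<in> signed S \<Longrightarrow> - x \<in> signed S"
  by (auto simp: plus_minus_def)

lemma signed_cases:
  assumes "x \<in> signed S"
  obtains "x \<in> S" | y where "y \<in> S" "x = - y" | "x = 0\<^sub>v n"
  using assms by (auto simp: plus_minus_def)

definition closed_frame :: "real vec set \<Rightarrow> bool" where
  "closed_frame S \<longleftrightarrow> orthonormal n S \<and> cross_set cp S S \<subseteq> signed S"

lemma closed_frameD:
  assumes "closed_frame S"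
  shows "s \<in> S \<Longrightarrow> s \<in> carrier_vec n" "s \<in> S \<Longrightarrow> s \<bullet> s = 1"
    "s \<in> S \<Longrightarrow> t \<in> S \<Longrightarrow> s \<noteq> t \<Longrightarrow> s \<bullet> t = 0" "s \<in> S \<Longrightarrow> t \<in> S \<Longrightarrow> s \<star> t \<in> signed S"
    "finite S"
  using assms unfolding closed_frame_def orthonormal_def cross_set_def by blast+

lemma signed_orthogonal:
  assumes "S \<subseteq> carrier_vec n" "w \<in> carrier_vec n" "\<And>s. s \<in> S \<Longrightarrow> s \<bullet> w = 0" "x \<in> signed S"
  shows "x \<bullet> w = 0"
  using assms(4) by (rule signed_cases) (use assms in \<open>auto simp: subset_iff\<close>)

lemma signed_cross:
  assumes S: "closed_frame S" and x: "x \<in> signed S" and t: "t \<in> S"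
  shows "x \<star> t \<in> signed S"
  using x
proof (rule signed_cases)
  fix y assume "y \<in> S" "x = - y"
  then show ?thesis
    using closed_frameD[OF S] t by (simp only: minus_left signed_uminus)
next
  assume "x = 0\<^sub>v n"
  then show ?thesis using closed_frameD(1)[OF S t] by (simp add: zero_left)
qed (use closed_frameD[OF S] t in auto)

text \<open>The Cayley-Dickson doubling step. Since \<open>z\<close> is orthogonal to \<open>S\<close> and \<open>S\<close> is closed up to
  sign, the alternating form gives \<open>t \<bullet> (z \<star> s) = - (z \<bullet> (t \<star> s)) = 0\<close>, so that \<open>z\<close> and \<open>z \<star> S\<close> are
  new orthogonal directions. The products of the new set are found from
  \<open>s \<star> (z \<star> t) = - (z \<star> (s \<star> t))\<close> and \<open>(z \<star> s) \<star> (z \<star> t) = t \<star> s\<close> for \<open>s \<noteq> t\<close>.\<close>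

lemma closed_frame_double:
  assumes S: "closed_frame S" and z [simp]: "z \<in> carrier_vec n" and zz: "z \<bullet> z = 1"
    and zS: "\<And>s. s \<in> S \<Longrightarrow> s \<bullet> z = 0"
  shows "closed_frame (insert z (S \<union> cp z ` S))" (is "closed_frame ?T")
    and "card (insert z (S \<union> cp z ` S)) = 2 * card S + 1"
proof -
  note [simp] = closed_frameD(1)[OF S]
  note D = closed_frameD[OF S]
  have Sc: "S \<subseteq> carrier_vec n" by auto
  have Sz: "z \<bullet> s = 0" if "s \<in> S" for s
    using zS[OF that] that comm_scalar_prod[of z n s] by simp
  have St: "t \<bullet> (z \<star> s) = 0" if "s \<in> S" "t \<in> S" for s t
    using triple_swap_left[of t z s] signed_orthogonal[OF Sc z zS D(4)[OF that(2,1)]] that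
      comm_scalar_prod[of z n "t \<star> s"] by simp
  have tS: "(z \<star> s) \<bullet> t = 0" if "s \<in> S" "t \<in> S" for s t
    using St[OF that] that comm_scalar_prod[of t n "z \<star> s"] by simp
  have pz: "z \<bullet> (z \<star> s) = 0" "(z \<star> s) \<bullet> z = 0" if "s \<in> S" for s
    using that perp_left[of z s] comm_scalar_prod[of z n "z \<star> s"] by simp_all
  have dd: "(z \<star> s) \<bullet> (z \<star> t) = s \<bullet> t" if "s \<in> S" "t \<in> S" for s t
    using polarized_pythagoras[of z s t] that zz Sz by simp
  have dd0: "s \<bullet> t = 0" if "s \<in> S" "t \<in> S" "z \<star> s \<noteq> z \<star> t" for s t
    using D(3)[OF that(1,2)] that(3) by blast
  have zzs: "z \<star> (z \<star> s) = - s" if "s \<in> S" for s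
    using cross_cross_unit[of z s] that zz Sz by simp
  have in1: "x \<in> signed ?T" if "x \<in> signed S" for x
    using that by (auto simp: plus_minus_def)
  have in2: "z \<star> x \<in> signed ?T" if "x \<in> signed S" for x
    using that
  proof (rule signed_cases)
    fix y assume "y \<in> S" "x = - y"
    then show ?thesis by (auto simp: minus_right plus_minus_def)
  next
    assume "x = 0\<^sub>v n"
    then show ?thesis by (simp add: zero_right)
  qed (auto simp: plus_minus_def)
  have mixed: "s \<star> (z \<star> t) \<in> signed ?T" if "s \<in> S" "t \<in> S" for s t
  proof (cases "s = t")
    case True
    have "s \<star> (z \<star> s) = z"
      using anticommute[of z s] cross_cross_unit[of s z] that zS D(2) by (simp add: minus_right)
    then show ?thesis using True by (simp add: plus_minus_def)
  next
    case False
    have "s \<star> (z \<star> t) = - (z \<star> (s \<star> t))"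
      by (rule swap_orthogonal) (use that False zS Sz D(3) in auto)
    then show ?thesis using signed_uminus[OF in2[OF D(4)[OF that]]] by simp
  qed
  have both: "(z \<star> s) \<star> (z \<star> t) \<in> signed ?T" if "s \<in> S" "t \<in> S" for s t
  proof (cases "s = t")
    case True
    then show ?thesis using that by (simp add: self_zero)
  next
    case False
    have "(z \<star> s) \<star> (z \<star> t) = - (z \<star> ((z \<star> s) \<star> t))"
      by (rule swap_orthogonal) (use that Sz tS pz in auto)
    also have "(z \<star> s) \<star> t = - (z \<star> (s \<star> t))"
      using anti_associate[of z s t] False that Sz D(3) by simp
    also have "z \<star> - (z \<star> (s \<star> t)) = - (z \<star> (z \<star> (s \<star> t)))"
      using that by (simp add: minus_right)
    also have "z \<star> (z \<star> (s \<star> t)) = - (s \<star> t)"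
      using cross_cross_unit[of z "s \<star> t"] that zz signed_orthogonal[OF Sc z zS D(4)[OF that]]
        comm_scalar_prod[of z n "s \<star> t"] by simp
    finally show ?thesis
      using signed_uminus[OF in1[OF D(4)[OF that]]] by simp
  qed
  have "orthonormal n ?T"
    unfolding orthonormal_def using zz Sz zS St tS pz dd dd0 D(2,3,5) by auto
  moreover have "x \<star> y \<in> signed ?T" if "x \<in> ?T" "y \<in> ?T" for x y
  proof -
    from that consider "x = z" "y = z" | "x = z" "y \<in> S" | s where "x = z" "s \<in> S" "y = z \<star> s"
      | "x \<in> S" "y = z" | "x \<in> S" "y \<in> S" | t where "x \<in> S" "t \<in> S" "y = z \<star> t"
      | s where "s \<in> S" "x = z \<star> s" "y = z" | s where "s \<in> S" "x = z \<star> s" "y \<in> S"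
      | s t where "s \<in> S" "t \<in> S" "x = z \<star> s" "y = z \<star> t"
      by blast
    then show ?thesis
    proof cases
      case 1 then show ?thesis by (simp add: self_zero)
    next
      case 2 then show ?thesis by (simp add: plus_minus_def)
    next
      case 3 then show ?thesis by (simp add: zzs plus_minus_def)
    next
      case 4 then show ?thesis using anticommute[of x z] by (simp add: plus_minus_def)
    next
      case 5 then show ?thesis using in1[OF D(4)] by blast
    next
      case 6 then show ?thesis using mixed by simp
    next
      case 7 then show ?thesis using anticommute[of x z] by (simp add: zzs plus_minus_def)
    next
      case 8 then show ?thesis
        using anticommute[of x y] signed_uminus[OF mixed[of y s]] by simp
    next
      case 9 then show ?thesis using both by simp
    qed
  qed
  ultimately show "closed_frame ?T"
    unfolding closed_frame_def cross_set_def by blast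
  have "z \<notin> S" using zS[of z] zz by auto
  moreover have "z \<noteq> z \<star> s" if "s \<in> S" for s
    using pz(1)[OF that] zz by auto
  then have "z \<notin> cp z ` S" by blast
  moreover have "t \<noteq> z \<star> s" if "s \<in> S" "t \<in> S" for s t
    using St[OF that] D(2)[OF that(2)] by auto
  then have "S \<inter> cp z ` S = {}" by blast
  moreover have "inj_on (cp z) S"
  proof (rule inj_onI, rule ccontr)
    fix s t assume st: "s \<in> S" "t \<in> S" "z \<star> s = z \<star> t" "s \<noteq> t"
    then have "s \<bullet> s = s \<bullet> t" using dd[of s t] dd[of s s] by simp
    then show False using D(2)[OF st(1)] D(3)[OF st(1,2,4)] by simp
  qed
  ultimately show "card ?T = 2 * card S + 1"
    using D(5) by (simp add: card_Un_disjoint card_image)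
qed

lemma closed_frame_grow:
  assumes "closed_frame S" "card S < n"
  shows "\<exists>T. closed_frame T \<and> card T = 2 * card S + 1"
proof -
  obtain z where "z \<in> carrier_vec n" "z \<bullet> z = 1" "\<And>s. s \<in> S \<Longrightarrow> s \<bullet> z = 0"
    using exists_unit_orthogonal assms unfolding closed_frame_def by metis
  then show ?thesis using closed_frame_double[OF assms(1)] by metis
qed

lemma card_closed_frame_le: "closed_frame S \<Longrightarrow> card S \<le> n"
  using card_orthonormal_le unfolding closed_frame_def by blast

text \<open>Seven elements leave room to choose \<open>z\<close> different from \<open>s\<close>, \<open>t\<close> and \<open>\<plusminus> (s \<star> t)\<close>, which is
  what makes \<open>s\<close>, \<open>t\<close>, \<open>z\<close> generic. All products of them lie in \<open>S\<close> up to sign, so a unit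
  vector \<open>w\<close> orthogonal to \<open>S\<close> would complete a forbidden quadruple.\<close>

lemma closed_frame_7_maximal:
  assumes S: "closed_frame S" and card: "card S = 7"
  shows "n = 7"
proof (rule ccontr)
  assume "n \<noteq> 7"
  then have "card S < n" using card_closed_frame_le[OF S] card by simp
  then obtain w where w: "w \<in> carrier_vec n" "w \<bullet> w = 1" "\<And>s. s \<in> S \<Longrightarrow> s \<bullet> w = 0"
    using exists_unit_orthogonal S unfolding closed_frame_def by metis
  note D = closed_frameD[OF S]
  have Sc: "S \<subseteq> carrier_vec n" using D by auto
  obtain A where "A \<subseteq> S" "card A = 2"
    using obtain_subset_with_card_n[of 2 S] card by auto
  then obtain s t where st: "s \<in> S" "t \<in> S" "s \<noteq> t"
    by (auto simp: card_2_iff)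
  have "card {s, t, s \<star> t, - (s \<star> t)} \<le> 4"
    by (simp add: card_insert_if)
  then obtain z where z: "z \<in> S" "z \<notin> {s, t, s \<star> t, - (s \<star> t)}"
    using card card_mono[of "{s, t, s \<star> t, - (s \<star> t)}" S] by fastforce
  have stz: "(s \<star> t) \<bullet> z = 0"
    using D(4)[OF st(1,2)]
  proof (rule signed_cases)
    fix y assume y: "y \<in> S" "s \<star> t = - y"
    then have "y \<bullet> z = 0" using D(3)[OF y(1) z(1)] z(2) by auto
    then show ?thesis using uminus_scalar_prod[of y n z] D(1) y z(1) by simp
  qed (use z D in auto)
  note o = signed_orthogonal[OF Sc w(1) w(3)]
  show False
  proof (rule no_generic_quadruple[of s t z w])
    show "((s \<star> t) \<star> z) \<bullet> w = 0"
      using o signed_cross[OF S D(4)] st z by blast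
  qed (use w st z stz D o in auto)
qed

text \<open>Doubling from the empty frame produces the sizes \<open>0, 1, 3, 7\<close> until the frame fills the space,
  at the latest with seven elements. A dimension strictly between two of these sizes is impossible,
  because doubling would yield more orthonormal vectors than the dimension allows.\<close>

theorem dimension_and_full_frame: "n \<in> {0, 1, 3, 7} \<and> (\<exists>S. closed_frame S \<and> card S = n)"
proof -
  have 0: "closed_frame {}" by (auto simp: closed_frame_def orthonormal_def cross_set_def)
  show ?thesis
  proof (cases "n = 0")
    case False
    then obtain S1 where 1: "closed_frame S1" "card S1 = 1" using closed_frame_grow[OF 0] by auto
    show ?thesis
    proof (cases "n = 1")
      case False
      with 1 obtain S3 where 3: "closed_frame S3" "card S3 = 3"
        using closed_frame_grow[of S1] \<open>n \<noteq> 0\<close> by auto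
      show ?thesis
      proof (cases "n = 3")
        case False
        with 3 obtain S7 where 7: "closed_frame S7" "card S7 = 7"
          using closed_frame_grow[of S3] card_closed_frame_le[of S3] by auto
        then show ?thesis using closed_frame_7_maximal by blast
      qed (use 3 in auto)
    qed (use 1 in auto)
  qed (use 0 in auto)
qed

text \<open>Each \<open>s \<in> S\<close> is itself a product up to sign: for any other \<open>t \<in> S\<close> one has
  \<open>t \<star> (t \<star> s) = - s\<close>, where \<open>t \<star> s\<close> is up to sign an element of \<open>S\<close>. Anticommutativity then
  provides both signs.\<close>

lemma closed_frame_cross_set:
  assumes S: "closed_frame S" and card: "card S \<ge> 2"
  shows "cross_set cp S S = signed S"
proof
  show "cross_set cp S S \<subseteq> signed S" using S by (simp add: closed_frame_def)
  note D = closed_frameD[OF S]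
  have key: "s \<in> cross_set cp S S \<and> - s \<in> cross_set cp S S" if s: "s \<in> S" for s
  proof -
    have "\<not> S \<subseteq> {s}" using card card_mono[of "{s}" S] by auto
    then obtain t where t: "t \<in> S" "t \<noteq> s" by blast
    note [simp] = D(1)[OF s] D(1)[OF t(1)]
    let ?r = "t \<star> s"
    have tr: "t \<star> ?r = - s" "?r \<star> t = s"
      using cross_cross_unit[of t s] anticommute[of ?r t] D s t by auto
    have "?r \<noteq> 0\<^sub>v n"
      using pythagoras[of t s] D s t by (auto simp del: cross_carrier)
    with D(4)[OF t(1) s] consider "?r \<in> S" | q where "q \<in> S" "?r = - q"
      by (auto simp: plus_minus_def)
    then show ?thesis
    proof cases
      case 1
      then show ?thesis using tr t unfolding cross_set_def by force
    next
      case 2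
      then have "t \<star> q = s" "q \<star> t = - s"
        using tr anticommute[of q t] D(1)[OF 2(1)] by (auto simp: minus_left minus_right)
      then show ?thesis using 2 t unfolding cross_set_def by force
    qed
  qed
  obtain s where "s \<in> S" using card by fastforce
  then have "0\<^sub>v n \<in> cross_set cp S S"
    using self_zero[of s] D(1) unfolding cross_set_def by force
  then show "signed S \<subseteq> cross_set cp S S"
    using key by (auto simp: plus_minus_def)
qed

theorem exists_closed_frame_basis:
  assumes "n \<ge> 2"
  shows "\<exists>S. orthonormal_basis n S \<and> cross_set cp S S = signed S"
  using dimension_and_full_frame closed_frame_cross_set orthonormal_basisI assms
  unfolding closed_frame_def by metis

end

section \<open>Cross products in the four dimensions\<close>

lemma cross_product_trivial:
  assumes "n \<le> 1"
  shows "cross_product n (\<lambda>u v. 0\<^sub>v n)"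
proof -
  consider "n = 0" | "n = 1" using assms by linarith
  then show ?thesis
    by cases (auto simp: cross_product_def scalar_prod_def power2_eq_square)
qed

definition cross3 :: "real vec \<Rightarrow> real vec \<Rightarrow> real vec" where
  "cross3 u v = vec 3 (\<lambda>i.
    u $ ((i + 1) mod 3) * v $ ((i + 2) mod 3) - u $ ((i + 2) mod 3) * v $ ((i + 1) mod 3))"

lemma cross_product_cross3: "cross_product 3 cross3"
proof -
  have dot: "u \<bullet> v = u $ 0 * v $ 0 + u $ 1 * v $ 1 + u $ 2 * v $ 2"
    if "v \<in> carrier_vec 3" for u v :: "real vec"
    using that by (simp add: scalar_prod_def eval_nat_numeral)
  have car: "cross3 u v \<in> carrier_vec 3" for u v
    by (simp add: cross3_def)
  have comp: "cross3 u v $ 0 = u $ 1 * v $ 2 - u $ 2 * v $ 1"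
    "cross3 u v $ 1 = u $ 2 * v $ 0 - u $ 0 * v $ 2"
    "cross3 u v $ 2 = u $ 0 * v $ 1 - u $ 1 * v $ 0" for u v
    by (simp_all add: cross3_def numeral_2_eq_2)
  show ?thesis
    unfolding cross_product_def
  proof (intro conjI ballI allI)
    fix u u' v v' :: "real vec" and a b c d :: real
    assume uv: "u \<in> carrier_vec 3" "v \<in> carrier_vec 3"
    show "cross3 u v \<in> carrier_vec 3" by (rule car)
    show "u \<bullet> cross3 u v = 0" "v \<bullet> cross3 u v = 0"
      unfolding dot[OF car] comp by (simp_all add: algebra_simps)
    show "cross3 u v \<bullet> cross3 u v + (u \<bullet> v)\<^sup>2 = (u \<bullet> u) * (v \<bullet> v)"
      unfolding dot[OF car] dot[OF uv(1)] dot[OF uv(2)] comp power2_eq_square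
      by (simp only: ring_distribs) (simp add: algebra_simps)
    assume "u' \<in> carrier_vec 3" "v' \<in> carrier_vec 3"
    with uv show "cross3 (a \<cdot>\<^sub>v u + b \<cdot>\<^sub>v u') (c \<cdot>\<^sub>v v + d \<cdot>\<^sub>v v') =
        (a * c) \<cdot>\<^sub>v cross3 u v + (a * d) \<cdot>\<^sub>v cross3 u v' + (b * c) \<cdot>\<^sub>v cross3 u' v +
        (b * d) \<cdot>\<^sub>v cross3 u' v'"
      by (intro eq_vecI) (auto simp: cross3_def algebra_simps)
  qed
qed

text \<open>The imaginary octonions, with the unit vectors numbered such that
  \<open>e\<^sub>i \<star> e\<^sub>j = e\<^sub>k\<close> for \<open>j = i + 1\<close> and \<open>k = i + 3\<close> modulo \<open>7\<close>, and cyclically in \<open>i\<close>, \<open>j\<close>, \<open>k\<close>. The index triples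
  are the lines of the Fano plane; component \<open>i\<close> collects the three lines through \<open>i\<close>.\<close>

definition cross7 :: "real vec \<Rightarrow> real vec \<Rightarrow> real vec" where
  "cross7 u v = vec 7 (\<lambda>i.
    (u $ ((i + 1) mod 7) * v $ ((i + 3) mod 7) - u $ ((i + 3) mod 7) * v $ ((i + 1) mod 7)) +
    (u $ ((i + 2) mod 7) * v $ ((i + 6) mod 7) - u $ ((i + 6) mod 7) * v $ ((i + 2) mod 7)) +
    (u $ ((i + 4) mod 7) * v $ ((i + 5) mod 7) - u $ ((i + 5) mod 7) * v $ ((i + 4) mod 7)))"

text \<open>For the Pythagorean property put \<open>p\<^sub>i\<^sub>j = u\<^sub>i v\<^sub>j - u\<^sub>j v\<^sub>i\<close>. Each of the seven components of the product is
  a sum of three \<open>p\<^sub>i\<^sub>j\<close>, one for each line through a point. The \<open>21\<close> squares add up to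
  \<open>(u \<bullet> u) * (v \<bullet> v) - (u \<bullet> v)\<^sup>2\<close> by Lagrange's identity, and the \<open>21\<close> mixed products cancel in threes: each
  of the seven complements of lines contributes a Pluecker relation
  \<open>p\<^sub>i\<^sub>j p\<^sub>k\<^sub>l - p\<^sub>i\<^sub>k p\<^sub>j\<^sub>l + p\<^sub>i\<^sub>l p\<^sub>j\<^sub>k = 0\<close>.\<close>

lemma cross_product_cross7: "cross_product 7 cross7"
proof -
  have dot: "u \<bullet> v = u $ 0 * v $ 0 + u $ 1 * v $ 1 + u $ 2 * v $ 2 + u $ 3 * v $ 3 +
      u $ 4 * v $ 4 + u $ 5 * v $ 5 + u $ 6 * v $ 6"
    if "v \<in> carrier_vec 7" for u v :: "real vec"
    using that by (simp add: scalar_prod_def eval_nat_numeral)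
  have car: "cross7 u v \<in> carrier_vec 7" for u v
    by (simp add: cross7_def)
  have comp:
    "cross7 u v $ 0 = (u$1*v$3 - u$3*v$1) + (u$2*v$6 - u$6*v$2) + (u$4*v$5 - u$5*v$4)"
    "cross7 u v $ 1 = (u$2*v$4 - u$4*v$2) + (u$3*v$0 - u$0*v$3) + (u$5*v$6 - u$6*v$5)"
    "cross7 u v $ 2 = (u$3*v$5 - u$5*v$3) + (u$4*v$1 - u$1*v$4) + (u$6*v$0 - u$0*v$6)"
    "cross7 u v $ 3 = (u$4*v$6 - u$6*v$4) + (u$5*v$2 - u$2*v$5) + (u$0*v$1 - u$1*v$0)"
    "cross7 u v $ 4 = (u$5*v$0 - u$0*v$5) + (u$6*v$3 - u$3*v$6) + (u$1*v$2 - u$2*v$1)"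
    "cross7 u v $ 5 = (u$6*v$1 - u$1*v$6) + (u$0*v$4 - u$4*v$0) + (u$2*v$3 - u$3*v$2)"
    "cross7 u v $ 6 = (u$0*v$2 - u$2*v$0) + (u$1*v$5 - u$5*v$1) + (u$3*v$4 - u$4*v$3)" for u v
    \<comment> \<open>Evaluating the remainders leaves indices \<open>Suc (Suc 0)\<close>, so the literal \<open>2\<close> is unfolded too.\<close>
    by (simp_all add: cross7_def numeral_2_eq_2)
  show ?thesis
    unfolding cross_product_def
  proof (intro conjI ballI allI)
    fix u u' v v' :: "real vec" and a b c d :: real
    assume uv: "u \<in> carrier_vec 7" "v \<in> carrier_vec 7"
    show "cross7 u v \<in> carrier_vec 7" by (rule car)
    show "u \<bullet> cross7 u v = 0" "v \<bullet> cross7 u v = 0"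
      unfolding dot[OF car] comp by (simp_all add: algebra_simps)
    show "cross7 u v \<bullet> cross7 u v + (u \<bullet> v)\<^sup>2 = (u \<bullet> u) * (v \<bullet> v)"
      unfolding dot[OF car] dot[OF uv(1)] dot[OF uv(2)] comp power2_eq_square
      by (simp only: ring_distribs) (simp add: algebra_simps)
    assume "u' \<in> carrier_vec 7" "v' \<in> carrier_vec 7"
    with uv show "cross7 (a \<cdot>\<^sub>v u + b \<cdot>\<^sub>v u') (c \<cdot>\<^sub>v v + d \<cdot>\<^sub>v v') =
        (a * c) \<cdot>\<^sub>v cross7 u v + (a * d) \<cdot>\<^sub>v cross7 u v' + (b * c) \<cdot>\<^sub>v cross7 u' v +
        (b * d) \<cdot>\<^sub>v cross7 u' v'"
      by (intro eq_vecI) (auto simp: cross7_def algebra_simps)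
  qed
qed

section \<open>The classification\<close>

theorem theorem1:
  shows "(\<forall>n. (\<exists>cp. cross_product n cp) \<longleftrightarrow> n \<in> {0, 1, 3, 7}) \<and>
    (\<forall>cp. cross_product 3 cp \<longrightarrow>
      (\<exists>S1. orthonormal_basis 3 S1 \<and> cross_set cp S1 S1 = plus_minus S1 \<union> {0\<^sub>v 3})) \<and>
    (\<forall>cp. cross_product 7 cp \<longrightarrow>
      (\<exists>S2. orthonormal_basis 7 S2 \<and> cross_set cp S2 S2 = plus_minus S2 \<union> {0\<^sub>v 7}))"
proof (intro conjI allI impI)
  fix n
  show "(\<exists>cp. cross_product n cp) \<longleftrightarrow> n \<in> {0, 1, 3, 7}"
  proof
    assume "\<exists>cp. cross_product n cp"
    then obtain cp where "cross_product_on n cp"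
      unfolding cross_product_on_def by blast
    then show "n \<in> {0, 1, 3, 7}"
      using cross_product_on.dimension_and_full_frame by blast
  next
    assume "n \<in> {0, 1, 3, 7}"
    then consider "n \<le> 1" | "n = 3" | "n = 7" by auto
    then show "\<exists>cp. cross_product n cp"
      using cross_product_trivial cross_product_cross3 cross_product_cross7 by cases blast+
  qed
next
  fix cp assume "cross_product 3 cp"
  then show "\<exists>S1. orthonormal_basis 3 S1 \<and> cross_set cp S1 S1 = plus_minus S1 \<union> {0\<^sub>v 3}"
    using cross_product_on.exists_closed_frame_basis[of 3 cp] by (simp add: cross_product_on_def)
next
  fix cp assume "cross_product 7 cp"
  then show "\<exists>S2. orthonormal_basis 7 S2 \<and> cross_set cp S2 S2 = plus_minus S2 \<union> {0\<^sub>v 7}"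
    using cross_product_on.exists_closed_frame_basis[of 7 cp] by (simp add: cross_product_on_def)
qed

end
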